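(* Let $\mathcal{F}$ be a real Hilbert space, let $\Phi:\mathcal{F}\to(-\infty,\infty]$ be a generator, let $\mathcal{A}=\operatorname{int}(\operatorname{dom}\Phi)$, and let $d_\Phi$ be the functional Bregman divergence generated by $\Phi$. Then: 1. (Nonnegativity and identity of indiscernibles) For all $f,g\in\mathcal{A}$, $d_\Phi(f,g)\ge 0$, and $d_\Phi(f,g)=0$ if and only if $f=g$. 2. (Convexity in the first argument) For every fixed $q\in\mathcal{A}$, the function $d_\Phi(\cdot,q):\mathcal{A}\to[0,\infty)$ is strictly convex. 3. (Linearity in the generator) For any two generators $\Phi_1:\mathcal{F}\to\mathbb{R}$ and $\Phi_2:\mathcal{F}\to\mathbb{R}$ and any $\lambda\ge 0$, $d_{\Phi_1+\lambda\Phi_2}=d_{\Phi_1}+\lambda d_{\Phi_2}$. 4. (Three point identity) For all $f,g,h\in\mathcal{A}$, $$d_\Phi(f,g)=d_\Phi(f,h)+d_\Phi(h,g)-\langle\nabla\Phi(g)-\nabla\Phi(h),\,f-h\rangle_{\mathcal{F}}.$$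
   Context: A function $\Phi:\mathcal{F}\to(-\infty,\infty]$ on a real Hilbert space $\mathcal{F}$ is called a generator if it is proper, lower semicontinuous, strictly convex, and Fréchet differentiable on $\mathcal{A}=\operatorname{int}(\operatorname{dom}\Phi)$, where $\mathcal{A}\neq\emptyset$ and $\operatorname{dom}\Phi=\{f:\Phi(f)<\infty\}$. The Fréchet gradient $\nabla\Phi(g)\in\mathcal{F}$ at $g\in\mathcal{A}$ is the Riesz representer of the Fréchet derivative. The functional Bregman divergence $d_\Phi:\mathcal{A}\times\mathcal{A}\to(-\infty,\infty)$ generated by $\Phi$ is $$d_\Phi(f,g)=\Phi(f)-\Phi(g)-\langle\nabla\Phi(g),f-g\rangle_{\mathcal{F}}.$$ *)

theory Defs
  imports "HOL-Analysis.Analysis"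
begin

definition effective_domain :: "('a \<Rightarrow> ereal) \<Rightarrow> 'a set" where
  "effective_domain \<Phi> = {f. \<Phi> f < \<infinity>}"

(* Values in (-\<infinity>, \<infinity>] and finite somewhere. *)
definition proper :: "('a \<Rightarrow> ereal) \<Rightarrow> bool" where
  "proper \<Phi> \<longleftrightarrow> (\<forall>f. \<Phi> f \<noteq> -\<infinity>) \<and> effective_domain \<Phi> \<noteq> {}"

definition lower_semicontinuous :: "('a::topological_space \<Rightarrow> ereal) \<Rightarrow> bool" where
  "lower_semicontinuous \<Phi> \<longleftrightarrow> (\<forall>f. \<Phi> f \<le> Liminf (at f) \<Phi>)"

definition strictly_convex_on :: "'a::real_vector set \<Rightarrow> ('a \<Rightarrow> real) \<Rightarrow> bool" where
  "strictly_convex_on S \<phi> \<longleftrightarrow> convex S \<and>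
     (\<forall>x\<in>S. \<forall>y\<in>S. \<forall>t. x \<noteq> y \<longrightarrow> 0 < t \<longrightarrow> t < 1 \<longrightarrow>
        \<phi> (t *\<^sub>R x + (1 - t) *\<^sub>R y) < t * \<phi> x + (1 - t) * \<phi> y)"

(* A proper extended-valued function is strictly convex iff its effective domain is convex
   and its (real-valued) restriction to that domain is strictly convex. On the interior of the
   effective domain, real_of_ereal (\<Phi> f) coincides locally with \<Phi>, so differentiability there
   is that of \<Phi> itself. *)
definition generator :: "('a::{real_inner, complete_space} \<Rightarrow> ereal) \<Rightarrow> bool" where
  "generator \<Phi> \<longleftrightarrow>
     proper \<Phi> \<and>
     lower_semicontinuous \<Phi> \<and>
     strictly_convex_on (effective_domain \<Phi>) (\<lambda>f. real_of_ereal (\<Phi> f)) \<and>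
     interior (effective_domain \<Phi>) \<noteq> {} \<and>
     (\<forall>g \<in> interior (effective_domain \<Phi>). (\<lambda>f. real_of_ereal (\<Phi> f)) differentiable (at g))"

(* GDERIV \<phi> g :> D says that h \<mapsto> inner h D is the Frechet derivative of \<phi> at g, i.e. that
   D is the Riesz representer of that derivative. Only meaningful for g in the interior of the
   effective domain of a generator. *)
definition frechet_gradient :: "('a::{real_inner, complete_space} \<Rightarrow> ereal) \<Rightarrow> 'a \<Rightarrow> 'a" where
  "frechet_gradient \<Phi> g = (THE D. GDERIV (\<lambda>f. real_of_ereal (\<Phi> f)) g :> D)"

(* Only meaningful for a generator and f, g in the interior of its effective domain. *)
definition bregman_div ::
    "('a::{real_inner, complete_space} \<Rightarrow> ereal) \<Rightarrow> 'a \<Rightarrow> 'a \<Rightarrow> real" where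
  "bregman_div \<Phi> f g =
     real_of_ereal (\<Phi> f) - real_of_ereal (\<Phi> g) - inner (frechet_gradient \<Phi> g) (f - g)"

end

theory Submission
  imports Defs
begin

text \<open>
  Restricting a generator to a line turns strict convexity and differentiability into the strict
  gradient inequality, which is part 1. The divergence in its first argument
  differs from the generator by an affine function, which gives part 2. Parts 1 and 3 need gradients to
  exist as vectors, that is, the Riesz representation theorem; here the representer of a bounded
  functional \<open>F\<close> is the minimiser of \<open>\<lambda>x. \<parallel>x\<parallel>\<^sup>2 - 2 F x\<close>, whose minimising sequences are Cauchy by
  the parallelogram law.
\<close>

section \<open>The Riesz representation theorem\<close>

lemma riesz_representation:
  fixes F :: "'a::{real_inner, complete_space} \<Rightarrow> real"
  assumes "bounded_linear F"
  obtains D where "\<And>h. F h = inner h D"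
proof -
  interpret F: bounded_linear F by fact
  define q where "q x = inner x x - 2 * F x" for x
  obtain K where K: "\<And>x. norm (F x) \<le> norm x * K" using F.bounded by blast
  \<comment> \<open>Completing the square in \<open>norm x\<close>, with \<open>K\<close> a bound
    for the operator norm of \<open>F\<close>.\<close>
  have lower: "- (K\<^sup>2) \<le> q x" for x
  proof -
    have "0 \<le> (norm x - K)\<^sup>2" by simp
    then have "- (K\<^sup>2) \<le> (norm x)\<^sup>2 - 2 * (norm x * K)"
      by (simp add: power2_eq_square algebra_simps)
    also have "\<dots> \<le> q x"
      using K[of x] by (simp add: q_def power2_norm_eq_inner)
    finally show ?thesis .
  qed
  define m where "m = Inf (range q)"
  have bdd: "bdd_below (range q)" using lower by (rule bdd_belowI2)
  have m_le: "m \<le> q x" for x unfolding m_def using bdd by (auto intro: cInf_lower)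
  have "\<exists>x. q x < m + inverse (real (Suc n))" for n
  proof -
    have "Inf (range q) < m + inverse (real (Suc n))" by (simp add: m_def)
    then show ?thesis using bdd by (subst (asm) cInf_less_iff) auto
  qed
  then obtain X where X: "\<And>n. q (X n) < m + inverse (real (Suc n))" by metis
  \<comment> \<open>The linear part of \<open>q\<close> cancels between \<open>x\<close>,
    \<open>y\<close> and their midpoint, leaving the parallelogram law. As \<open>q\<close> is at
    least \<open>m\<close> at the midpoint, two near-minimisers must be close to each other.\<close>
  have parallelogram: "(norm (x - y))\<^sup>2 \<le> 2 * (q x + q y - 2 * m)" for x y
  proof -
    have "(norm (x - y))\<^sup>2 = 2 * (q x + q y - 2 * q ((1/2) *\<^sub>R (x + y)))"
      unfolding power2_norm_eq_inner q_def F.scaleR F.add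
      by (simp add: inner_simps inner_commute algebra_simps)
    then show ?thesis using m_le[of "(1/2) *\<^sub>R (x + y)"] by simp
  qed
  have "Cauchy X"
  proof (rule metric_CauchyI)
    fix e :: real assume "e > 0"
    \<comment> \<open>Both values of \<open>q\<close> exceed \<open>m\<close> by less than
      \<open>inverse (Suc N)\<close>, so the bound above is below four times that number.\<close>
    then obtain N where N: "inverse (real (Suc N)) < e\<^sup>2 / 4"
      using reals_Archimedean[of "e\<^sup>2 / 4"] by auto
    have "dist (X i) (X j) < e" if "N \<le> i" "N \<le> j" for i j
    proof -
      have "inverse (real (Suc i)) \<le> inverse (real (Suc N))"
           "inverse (real (Suc j)) \<le> inverse (real (Suc N))"
        using that by auto
      then have "(norm (X i - X j))\<^sup>2 < e\<^sup>2"
        using parallelogram[of "X i" "X j"] X[of i] X[of j] N by argo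
      then show ?thesis using \<open>e > 0\<close> by (auto simp: dist_norm intro: power2_less_imp_less)
    qed
    then show "\<exists>N. \<forall>i\<ge>N. \<forall>j\<ge>N. dist (X i) (X j) < e" by blast
  qed
  then obtain D where D: "X \<longlonglongrightarrow> D"
    using Cauchy_convergent convergent_def by blast
  have "(\<lambda>n. q (X n)) \<longlonglongrightarrow> q D"
    unfolding q_def by (intro tendsto_intros F.tendsto D)
  moreover have "(\<lambda>n. m + inverse (real (Suc n))) \<longlonglongrightarrow> m + 0"
    by (intro tendsto_intros LIMSEQ_inverse_real_of_nat)
  ultimately have "q D \<le> m + 0"
    by (rule LIMSEQ_le) (use X in \<open>auto intro: less_imp_le\<close>)
  then have D_min: "q D \<le> q x" for x using m_le[of x] by simp
  have "F h = inner h D" for h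
  proof (cases "h = 0")
    case False
    define c where "c = F h - inner h D"
    \<comment> \<open>This \<open>t\<close> minimises the quadratic
      \<open>q (D + t *\<^sub>R h)\<close>. It lowers \<open>q D\<close> by
      \<open>c\<^sup>2 / inner h h\<close>, which minimality of \<open>D\<close> allows only for
      \<open>c = 0\<close>.\<close>
    define t where "t = c / inner h h"
    have h_pos: "inner h h > 0" using False by simp
    have "q (D + t *\<^sub>R h) = q D - 2 * t * c + t\<^sup>2 * inner h h"
      unfolding q_def c_def F.add F.scaleR
      by (simp add: inner_simps inner_commute algebra_simps power2_eq_square)
    also have "\<dots> = q D - c\<^sup>2 / inner h h"
      using h_pos by (simp add: t_def power2_eq_square field_simps)
    finally have "c\<^sup>2 / inner h h \<le> 0" using D_min[of "D + t *\<^sub>R h"] by simp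
    then have "c = 0" using h_pos by (simp add: divide_le_0_iff)
    then show ?thesis by (simp add: c_def)
  qed (simp add: F.zero)
  then show thesis by (rule that)
qed

section \<open>Gradients and the gradient inequality\<close>

lemma differentiable_imp_GDERIV:
  fixes f :: "'a::{real_inner, complete_space} \<Rightarrow> real"
  assumes "f differentiable (at x)"
  obtains D where "GDERIV f x :> D"
proof -
  obtain F where F: "(f has_derivative F) (at x)" using assms by (auto simp: differentiable_def)
  obtain D where "\<And>h. F h = inner h D"
    using riesz_representation[OF has_derivative_bounded_linear[OF F]] by blast
  then have "F = (\<lambda>h. inner h D)" by auto
  with F show thesis using that by (simp add: gderiv_def)
qed

lemma GDERIV_unique:
  assumes "GDERIV f x :> D" "GDERIV f x :> E"
  shows "D = E"
proof -
  have "(\<lambda>h. inner h D) = (\<lambda>h. inner h E)"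
    using assms unfolding gderiv_def by (rule has_derivative_unique)
  then have "inner (D - E) D = inner (D - E) E" by metis
  then have "inner (D - E) (D - E) = 0" by (simp add: inner_diff_right)
  then show ?thesis by simp
qed

lemma frechet_gradient_eqI:
  assumes "GDERIV (\<lambda>f. real_of_ereal (\<Phi> f)) g :> D"
  shows "frechet_gradient \<Phi> g = D"
  unfolding frechet_gradient_def
  by (rule the_equality[where P = "gderiv _ _", OF assms]) (rule GDERIV_unique[OF _ assms])

lemma GDERIV_frechet_gradient:
  assumes "generator \<Phi>" "g \<in> interior (effective_domain \<Phi>)"
  shows "GDERIV (\<lambda>f. real_of_ereal (\<Phi> f)) g :> frechet_gradient \<Phi> g"
proof -
  have "(\<lambda>f. real_of_ereal (\<Phi> f)) differentiable (at g)"
    using assms by (simp add: generator_def)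
  then obtain D where "GDERIV (\<lambda>f. real_of_ereal (\<Phi> f)) g :> D"
    by (rule differentiable_imp_GDERIV)
  then show ?thesis using frechet_gradient_eqI by metis
qed

text \<open>Convexity bounds the difference quotients along the segment from \<open>y\<close> to
  \<open>x\<close> by the full increment of the function. Their limit at \<open>y\<close> is the
  directional derivative, and a limit preserves only the weak inequality.\<close>

lemma strictly_convex_on_imp_gradient_le:
  fixes \<phi> :: "'a::real_inner \<Rightarrow> real"
  assumes sc: "strictly_convex_on S \<phi>" and "x \<in> S" "y \<in> S"
    and deriv: "GDERIV \<phi> y :> D"
  shows "inner (x - y) D \<le> \<phi> x - \<phi> y"
proof (cases "x = y")
  case False
  define s where "s t = \<phi> (y + t *\<^sub>R (x - y))" for t
  have line: "((\<lambda>t. y + t *\<^sub>R (x - y)) has_derivative (\<lambda>t. t *\<^sub>R (x - y))) (at 0)"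
    by (auto intro!: derivative_eq_intros)
  \<comment> \<open>The base point is written as the value of the line at 0, the form the chain rule
    expects.\<close>
  have "(\<phi> has_derivative (\<lambda>h. inner h D)) (at (y + 0 *\<^sub>R (x - y)))"
    using deriv by (simp add: gderiv_def)
  from has_derivative_compose[OF line this]
  have "(s has_derivative (\<lambda>t. inner (t *\<^sub>R (x - y)) D)) (at 0)"
    unfolding s_def .
  then have "(s has_real_derivative inner (x - y) D) (at 0)"
    by (simp add: has_field_derivative_def mult_commute_abs)
  then have "((\<lambda>t. (s t - s 0) / t) \<longlongrightarrow> inner (x - y) D) (at 0)"
    by (simp add: DERIV_def)
  \<comment> \<open>Only the right-hand limit matters: the convexity bound concerns 0 < t <
    1.\<close>
  then have lim: "((\<lambda>t. (s t - s 0) / t) \<longlongrightarrow> inner (x - y) D) (at_right 0)"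
    by (rule filterlim_mono) (auto simp: at_le)
  have "(s t - s 0) / t \<le> \<phi> x - \<phi> y" if "0 < t" "t < 1" for t
  proof -
    have "y + t *\<^sub>R (x - y) = t *\<^sub>R x + (1 - t) *\<^sub>R y" by (simp add: algebra_simps)
    then have "s t < t * \<phi> x + (1 - t) * \<phi> y"
      using sc that False assms(2,3) by (simp add: strictly_convex_on_def s_def)
    then show ?thesis using that by (simp add: s_def field_simps)
  qed
  then have "\<forall>\<^sub>F t in at_right 0. (s t - s 0) / t \<le> \<phi> x - \<phi> y"
    by (auto simp: eventually_at_right_field intro!: exI[of _ 1])
  then show ?thesis by (intro tendsto_upperbound[OF lim]) auto
qed simp

text \<open>Strictness comes from applying the weak inequality at the midpoint of \<open>x\<close> and \<open>y\<close>.\<close>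

lemma strictly_convex_on_imp_gradient_less:
  fixes \<phi> :: "'a::real_inner \<Rightarrow> real"
  assumes sc: "strictly_convex_on S \<phi>" and S: "x \<in> S" "y \<in> S" and "x \<noteq> y"
    and deriv: "GDERIV \<phi> y :> D"
  shows "inner (x - y) D < \<phi> x - \<phi> y"
proof -
  define p where "p = (1/2) *\<^sub>R x + (1 - 1/2) *\<^sub>R y"
  have "\<phi> (t *\<^sub>R x + (1 - t) *\<^sub>R y) < t * \<phi> x + (1 - t) * \<phi> y" if "0 < t" "t < 1" for t
    using sc S \<open>x \<noteq> y\<close> that by (simp add: strictly_convex_on_def)
  from this[of "1/2"] have "\<phi> p < (1/2) * \<phi> x + (1 - 1/2) * \<phi> y"
    unfolding p_def by linarith
  moreover have "p \<in> S"
    using sc S unfolding strictly_convex_on_def p_def by (auto intro: convexD)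
  then have "inner (p - y) D \<le> \<phi> p - \<phi> y"
    using strictly_convex_on_imp_gradient_le[OF sc _ S(2) deriv] by blast
  \<comment> \<open>Now half the inner product is at most the increment from \<open>y\<close> to
    \<open>p\<close>, which is strictly less than half the increment from \<open>y\<close> to
    \<open>x\<close>.\<close>
  moreover have "p - y = (1/2) *\<^sub>R (x - y)"
    by (simp add: p_def algebra_simps flip: scaleR_add_left)
  ultimately show ?thesis by simp
qed

section \<open>Stability of strict convexity and linearity in the generator\<close>

lemma effective_domain_ereal [simp]: "effective_domain (\<lambda>f. ereal (\<phi> f)) = UNIV"
  by (simp add: effective_domain_def)

lemma strictly_convex_on_subset:
  assumes "strictly_convex_on S \<phi>" "T \<subseteq> S" "convex T"
  shows "strictly_convex_on T \<phi>"
  using assms by (auto simp: strictly_convex_on_def subset_iff)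

text \<open>The subtracted terms have the shape of \<open>bregman_div\<close> in its first argument.
  Being affine, they contribute equally to both sides of the convexity inequality.\<close>

lemma strictly_convex_on_diff_affine:
  fixes \<phi> :: "'a::real_inner \<Rightarrow> real"
  assumes "strictly_convex_on S \<phi>"
  shows "strictly_convex_on S (\<lambda>f. \<phi> f - a - inner D (f - b))"
  unfolding strictly_convex_on_def
proof (intro conjI ballI allI impI)
  show "convex S" using assms by (simp add: strictly_convex_on_def)
next
  fix x y t assume "x \<in> S" "y \<in> S" "x \<noteq> y" "0 < (t::real)" "t < 1"
  then have "\<phi> (t *\<^sub>R x + (1 - t) *\<^sub>R y) < t * \<phi> x + (1 - t) * \<phi> y"
    using assms by (simp add: strictly_convex_on_def)
  then show "\<phi> (t *\<^sub>R x + (1 - t) *\<^sub>R y) - a - inner D (t *\<^sub>R x + (1 - t) *\<^sub>R y - b)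
      < t * (\<phi> x - a - inner D (x - b)) + (1 - t) * (\<phi> y - a - inner D (y - b))"
    by (simp add: inner_simps algebra_simps)
qed

lemma strictly_convex_on_add_scaled:
  assumes "strictly_convex_on S \<phi>" "strictly_convex_on S \<psi>" "c \<ge> 0"
  shows "strictly_convex_on S (\<lambda>f. \<phi> f + c * \<psi> f)"
  unfolding strictly_convex_on_def
proof (intro conjI ballI allI impI)
  show "convex S" using assms by (simp add: strictly_convex_on_def)
next
  fix x y t assume xyt: "x \<in> S" "y \<in> S" "x \<noteq> y" "0 < (t::real)" "t < 1"
  then have "\<phi> (t *\<^sub>R x + (1 - t) *\<^sub>R y) < t * \<phi> x + (1 - t) * \<phi> y"
    using assms by (simp add: strictly_convex_on_def)
  \<comment> \<open>Since \<open>c\<close> may be 0, strictness has to come from the first summand;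
    the second enters with its weak inequality.\<close>
  moreover have "\<psi> (t *\<^sub>R x + (1 - t) *\<^sub>R y) \<le> t * \<psi> x + (1 - t) * \<psi> y"
    using assms xyt by (simp add: strictly_convex_on_def less_imp_le)
  then have "c * \<psi> (t *\<^sub>R x + (1 - t) *\<^sub>R y) \<le> c * (t * \<psi> x + (1 - t) * \<psi> y)"
    using \<open>c \<ge> 0\<close> by (rule mult_left_mono)
  ultimately show "\<phi> (t *\<^sub>R x + (1 - t) *\<^sub>R y) + c * \<psi> (t *\<^sub>R x + (1 - t) *\<^sub>R y)
      < t * (\<phi> x + c * \<psi> x) + (1 - t) * (\<phi> y + c * \<psi> y)"
    by (simp add: algebra_simps)
qed

lemma continuous_imp_lower_semicontinuous:
  fixes \<phi> :: "'a::t2_space \<Rightarrow> real"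
  assumes "\<And>x. isCont \<phi> x"
  shows "lower_semicontinuous (\<lambda>f. ereal (\<phi> f))"
  unfolding lower_semicontinuous_def
proof
  fix x
  show "ereal (\<phi> x) \<le> Liminf (at x) (\<lambda>f. ereal (\<phi> f))"
  \<comment> \<open>\<open>Liminf\<close> is taken over punctured neighbourhoods. At an isolated
    point the filter is trivial and \<open>Liminf\<close> is infinite; the zero space is such a
    case.\<close>
  proof (cases "at x = bot")
    case False
    have "((\<lambda>f. ereal (\<phi> f)) \<longlongrightarrow> ereal (\<phi> x)) (at x)"
      using assms[of x] by (simp add: isCont_def)
    then show ?thesis using lim_imp_Liminf[OF False] by (metis order_refl)
  qed (simp add: Liminf_bot top_ereal_def)
qed

text \<open>For finite-valued functions lower semicontinuity is automatic, since differentiability holds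
  on the whole space.\<close>

lemma generator_ereal_iff:
  fixes \<phi> :: "'a::{real_inner, complete_space} \<Rightarrow> real"
  shows "generator (\<lambda>f. ereal (\<phi> f)) \<longleftrightarrow>
    strictly_convex_on UNIV \<phi> \<and> (\<forall>g. \<phi> differentiable (at g))"
  by (auto simp: generator_def proper_def
      intro!: continuous_imp_lower_semicontinuous differentiable_imp_continuous_within)

text \<open>Ensures that the left-hand side of the linearity claim is itself the divergence of a
  generator.\<close>

lemma generator_add_scaled:
  fixes \<phi> \<psi> :: "'a::{real_inner, complete_space} \<Rightarrow> real"
  assumes "generator (\<lambda>f. ereal (\<phi> f))" "generator (\<lambda>f. ereal (\<psi> f))" "c \<ge> 0"
  shows "generator (\<lambda>f. ereal (\<phi> f + c * \<psi> f))"
  using assms unfolding generator_ereal_iff by (auto intro!: strictly_convex_on_add_scaled)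

text \<open>Gradients are unique, so it suffices that the combined vector represents the derivative
  of the sum.\<close>

lemma frechet_gradient_add_scaled:
  fixes \<phi> \<psi> :: "'a::{real_inner, complete_space} \<Rightarrow> real"
  assumes "generator (\<lambda>f. ereal (\<phi> f))" "generator (\<lambda>f. ereal (\<psi> f))"
  shows "frechet_gradient (\<lambda>f. ereal (\<phi> f + c * \<psi> f)) g =
    frechet_gradient (\<lambda>f. ereal (\<phi> f)) g + c *\<^sub>R frechet_gradient (\<lambda>f. ereal (\<psi> f)) g"
proof (rule frechet_gradient_eqI)
  show "GDERIV (\<lambda>f. real_of_ereal (ereal (\<phi> f + c * \<psi> f))) g :>
      frechet_gradient (\<lambda>f. ereal (\<phi> f)) g + c *\<^sub>R frechet_gradient (\<lambda>f. ereal (\<psi> f)) g"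
    using assms[THEN GDERIV_frechet_gradient, of g]
    by (auto simp: gderiv_def inner_simps intro!: derivative_eq_intros)
qed

lemma bregman_div_add_scaled:
  fixes \<phi> \<psi> :: "'a::{real_inner, complete_space} \<Rightarrow> real"
  assumes "generator (\<lambda>f. ereal (\<phi> f))" "generator (\<lambda>f. ereal (\<psi> f))"
  shows "bregman_div (\<lambda>f. ereal (\<phi> f + c * \<psi> f)) f g =
    bregman_div (\<lambda>f. ereal (\<phi> f)) f g + c * bregman_div (\<lambda>f. ereal (\<psi> f)) f g"
  by (simp add: bregman_div_def frechet_gradient_add_scaled[OF assms] inner_simps algebra_simps)

section \<open>Positivity, convexity and the three point identity\<close>

lemma bregman_div_self [simp]: "bregman_div \<Phi> f f = 0"
  by (simp add: bregman_div_def)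

lemma bregman_div_pos:
  assumes "generator \<Phi>" "f \<in> interior (effective_domain \<Phi>)"
    "g \<in> interior (effective_domain \<Phi>)" "f \<noteq> g"
  shows "bregman_div \<Phi> f g > 0"
proof -
  have "strictly_convex_on (effective_domain \<Phi>) (\<lambda>f. real_of_ereal (\<Phi> f))"
    using assms(1) by (simp add: generator_def)
  moreover have "f \<in> effective_domain \<Phi>" "g \<in> effective_domain \<Phi>"
    using assms(2,3) interior_subset by blast+
  ultimately show ?thesis
    using strictly_convex_on_imp_gradient_less \<open>f \<noteq> g\<close> GDERIV_frechet_gradient[OF assms(1,3)]
    by (fastforce simp: bregman_div_def inner_commute)
qed

lemma bregman_div_strictly_convex:
  assumes "generator \<Phi>"
  shows "strictly_convex_on (interior (effective_domain \<Phi>)) (\<lambda>f. bregman_div \<Phi> f q)"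
proof -
  have sc: "strictly_convex_on (effective_domain \<Phi>) (\<lambda>f. real_of_ereal (\<Phi> f))"
    using assms by (simp add: generator_def)
  then have "convex (interior (effective_domain \<Phi>))"
    by (auto simp: strictly_convex_on_def intro: convex_interior)
  with sc show ?thesis
    unfolding bregman_div_def
    by (intro strictly_convex_on_diff_affine) (rule strictly_convex_on_subset[OF _ interior_subset])
qed

text \<open>Pure algebra: the values at \<open>h\<close> cancel, and \<open>f - g\<close> splits as
  the sum of \<open>f - h\<close> and \<open>h - g\<close> in the term with the gradient at
  \<open>g\<close>.\<close>

lemma bregman_div_three_point:
  "bregman_div \<Phi> f g = bregman_div \<Phi> f h + bregman_div \<Phi> h g
     - inner (frechet_gradient \<Phi> g - frechet_gradient \<Phi> h) (f - h)"
  by (simp add: bregman_div_def inner_simps)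

theorem proposition7:
  fixes \<Phi> :: "'a::{real_inner, complete_space} \<Rightarrow> ereal"
    and A :: "'a set"
  assumes gen: "generator \<Phi>"
    and A_eq: "A = interior (effective_domain \<Phi>)"
  shows
    "(\<forall>f\<in>A. \<forall>g\<in>A. bregman_div \<Phi> f g \<ge> 0 \<and> (bregman_div \<Phi> f g = 0 \<longleftrightarrow> f = g))
   \<and> (\<forall>q\<in>A. strictly_convex_on A (\<lambda>f. bregman_div \<Phi> f q))
   \<and> (\<forall>(\<Phi>1::'a \<Rightarrow> real) (\<Phi>2::'a \<Rightarrow> real) (c::real).
        generator (\<lambda>f. ereal (\<Phi>1 f)) \<longrightarrow> generator (\<lambda>f. ereal (\<Phi>2 f)) \<longrightarrow> c \<ge> 0 \<longrightarrow>
        generator (\<lambda>f. ereal (\<Phi>1 f + c * \<Phi>2 f)) \<and>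
        (\<forall>f g. bregman_div (\<lambda>f. ereal (\<Phi>1 f + c * \<Phi>2 f)) f g =
               bregman_div (\<lambda>f. ereal (\<Phi>1 f)) f g + c * bregman_div (\<lambda>f. ereal (\<Phi>2 f)) f g))
   \<and> (\<forall>f\<in>A. \<forall>g\<in>A. \<forall>h\<in>A.
        bregman_div \<Phi> f g =
          bregman_div \<Phi> f h + bregman_div \<Phi> h g
          - inner (frechet_gradient \<Phi> g - frechet_gradient \<Phi> h) (f - h))"
proof (intro conjI)
  show "\<forall>f\<in>A. \<forall>g\<in>A. bregman_div \<Phi> f g \<ge> 0 \<and> (bregman_div \<Phi> f g = 0 \<longleftrightarrow> f = g)"
    \<comment> \<open>Both claims follow by distinguishing \<open>f = g\<close>, where the
      divergence vanishes, from distinct points, where it is positive.\<close>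
    unfolding A_eq using bregman_div_pos[OF gen] bregman_div_self
    by (metis less_irrefl less_imp_le order_refl)
  show "\<forall>q\<in>A. strictly_convex_on A (\<lambda>f. bregman_div \<Phi> f q)"
    unfolding A_eq using bregman_div_strictly_convex[OF gen] by blast
qed (blast intro: generator_add_scaled bregman_div_add_scaled bregman_div_three_point)+

end
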